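(* Let $(\xi_k)_{k\ge 1}$ be a decreasing (not necessarily strictly decreasing) sequence of positive real numbers, and let $\mathbf{R}\colon \ell^2\to\ell^2$ be the associated affine isometry defined in the context. Then $\mathbf{R}^{n!}(0)\to 0$ in norm as $n\to\infty$; in fact, $\|\mathbf{R}^{n!}(0)\| \le O\big(\tfrac1n\big)$, i.e., there is a constant $C\geq 0$ (which may depend on the sequence $(\xi_k)_{k\geq 1}$) such that $\|\mathbf{R}^{n!}(0)\|\le C/n$ for all sufficiently large $n$.
   Context: $\ell^2$ denotes the real Hilbert space of square-summable real sequences, viewed as the set of sequences $\mathbf{x}=(x_1,x_2,\ldots)$ with each $x_k\in\mathbb{R}^2$ and $\|\mathbf{x}\|^2=\sum_{k\ge1}\|x_k\|^2<\infty$ (Euclidean norm on each $\mathbb{R}^2$). For each integer $k\ge 1$, set $\theta_k = 2\pi/k!$ and define $R_k\colon\mathbb{R}^2\to\mathbb{R}^2$ by $$R_k x = \begin{pmatrix}\cos\theta_k & -\sin\theta_k\\ \sin\theta_k & \cos\theta_k\end{pmatrix}x + \xi_k\begin{pmatrix}1-\cos\theta_k\\ -\sin\theta_k\end{pmatrix}.$$ Define $\mathbf{R}(x_1,x_2,\ldots,x_k,\ldots) = (R_1x_1,R_2x_2,\ldots,R_kx_k,\ldots)$. Since $(\xi_k)_{k\geq 1}$ is positive and decreasing, $\mathbf{R}$ maps $\ell^2$ into $\ell^2$ and is an affine isometry. $\mathbf{R}^{m}$ denotes the $m$-fold composition of $\mathbf{R}$ with itself, and $0$ is the zero vector of $\ell^2$.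 *)

theory Defs
  imports "HOL-Analysis.Analysis"
begin

text \<open>Coordinate number \<open>i\<close> of an element of \<open>ell2\<close> (counted from 0) is \<open>x\<^sub>i\<^sub>+\<^sub>1\<close> of the usual
  1-based notation.\<close>

typedef ell2 = "{x :: nat \<Rightarrow> real^2. summable (\<lambda>i. (norm (x i))\<^sup>2)}"
  morphisms coord Abs_ell2
  by (rule exI[of _ "\<lambda>_. 0"]) simp

setup_lifting type_definition_ell2

lemma summable_norm_sq_add:
  fixes f g :: "nat \<Rightarrow> 'a::real_inner"
  assumes "summable (\<lambda>i. (norm (f i))\<^sup>2)" "summable (\<lambda>i. (norm (g i))\<^sup>2)"
  shows "summable (\<lambda>i. (norm (f i + g i))\<^sup>2)"
proof (rule summable_comparison_test')
  show "summable (\<lambda>i. 2 * (norm (f i))\<^sup>2 + 2 * (norm (g i))\<^sup>2)"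
    using assms by (intro summable_add summable_mult)
  fix i
  have "(norm (f i + g i))\<^sup>2 \<le> (norm (f i) + norm (g i))\<^sup>2"
    by (intro power_mono norm_triangle_ineq) auto
  also have "\<dots> \<le> 2 * (norm (f i))\<^sup>2 + 2 * (norm (g i))\<^sup>2"
    using zero_le_power2[of "norm (f i) - norm (g i)"]
    by (simp add: power2_sum power2_diff)
  finally show "norm ((norm (f i + g i))\<^sup>2) \<le> 2 * (norm (f i))\<^sup>2 + 2 * (norm (g i))\<^sup>2"
    by simp
qed

lemma summable_inner_of_norm_sq:
  fixes f g :: "nat \<Rightarrow> 'a::real_inner"
  assumes "summable (\<lambda>i. (norm (f i))\<^sup>2)" "summable (\<lambda>i. (norm (g i))\<^sup>2)"
  shows "summable (\<lambda>i. inner (f i) (g i))"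
proof (rule summable_comparison_test')
  show "summable (\<lambda>i. (norm (f i))\<^sup>2 + (norm (g i))\<^sup>2)"
    using assms by (rule summable_add)
  fix i
  have "norm (inner (f i) (g i)) \<le> norm (f i) * norm (g i)"
    using Cauchy_Schwarz_ineq2 by simp
  also have "\<dots> \<le> (norm (f i))\<^sup>2 + (norm (g i))\<^sup>2"
    using sum_squares_bound[of "norm (f i)" "norm (g i)"]
      mult_nonneg_nonneg[OF norm_ge_zero norm_ge_zero, of "f i" "g i"] by linarith
  finally show "norm (inner (f i) (g i)) \<le> (norm (f i))\<^sup>2 + (norm (g i))\<^sup>2" .
qed

lemma summable_coord: "summable (\<lambda>i. (norm (coord x i))\<^sup>2)"
  using coord[of x] by simp

instantiation ell2 :: real_vector
begin

lift_definition zero_ell2 :: ell2 is "\<lambda>_. 0" by simp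

lift_definition plus_ell2 :: "ell2 \<Rightarrow> ell2 \<Rightarrow> ell2" is "\<lambda>x y i. x i + y i"
  by (rule summable_norm_sq_add)

lift_definition uminus_ell2 :: "ell2 \<Rightarrow> ell2" is "\<lambda>x i. - x i" by simp

lift_definition minus_ell2 :: "ell2 \<Rightarrow> ell2 \<Rightarrow> ell2" is "\<lambda>x y i. x i - y i"
  subgoal for x y using summable_norm_sq_add[of x "\<lambda>i. - y i"] by simp
  done

lift_definition scaleR_ell2 :: "real \<Rightarrow> ell2 \<Rightarrow> ell2" is "\<lambda>c x i. c *\<^sub>R x i"
  by (simp add: power_mult_distrib summable_mult)

instance
  by standard (transfer; simp add: algebra_simps fun_eq_iff)+

end

instantiation ell2 :: real_inner
begin

definition inner_ell2 :: "ell2 \<Rightarrow> ell2 \<Rightarrow> real"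
  where "inner_ell2 x y = (\<Sum>i. inner (coord x i) (coord y i))"

definition norm_ell2 :: "ell2 \<Rightarrow> real"
  where "norm_ell2 x = sqrt (\<Sum>i. (norm (coord x i))\<^sup>2)"

definition dist_ell2 :: "ell2 \<Rightarrow> ell2 \<Rightarrow> real"
  where "dist_ell2 x y = norm (x - y)"

definition sgn_ell2 :: "ell2 \<Rightarrow> ell2"
  where "sgn_ell2 x = x /\<^sub>R norm x"

definition uniformity_ell2 :: "(ell2 \<times> ell2) filter"
  where "uniformity_ell2 = (INF e\<in>{0 <..}. principal {(x, y). dist x y < e})"

definition open_ell2 :: "ell2 set \<Rightarrow> bool"
  where "open_ell2 U = (\<forall>x\<in>U. eventually (\<lambda>(x', y). x' = x \<longrightarrow> y \<in> U) uniformity)"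

instance
proof
  fix x y z :: ell2 and r :: real and U :: "ell2 set"
  have si: "summable (\<lambda>i. inner (coord x i) (coord y i))" for x y
    by (rule summable_inner_of_norm_sq[OF summable_coord summable_coord])
  show "dist x y = norm (x - y)" by (rule dist_ell2_def)
  show "sgn x = x /\<^sub>R norm x" by (rule sgn_ell2_def)
  show "uniformity = (INF e\<in>{0 <..}. principal {(x :: ell2, y). dist x y < e})"
    by (rule uniformity_ell2_def)
  show "open U \<longleftrightarrow> (\<forall>x\<in>U. eventually (\<lambda>(x', y). x' = x \<longrightarrow> y \<in> U) uniformity)"
    by (rule open_ell2_def)
  show "inner x y = inner y x" by (simp add: inner_ell2_def inner_commute)
  show "inner (x + y) z = inner x z + inner y z"
    by (simp add: inner_ell2_def plus_ell2.rep_eq inner_add_left suminf_add[OF si si])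
  show "inner (r *\<^sub>R x) y = r * inner x y"
    by (simp add: inner_ell2_def scaleR_ell2.rep_eq suminf_mult[OF si])
  show "0 \<le> inner x x"
    unfolding inner_ell2_def by (rule suminf_nonneg[OF si]) simp
  show "inner x x = 0 \<longleftrightarrow> x = 0"
    unfolding inner_ell2_def
    by (subst suminf_eq_zero_iff[OF si]) (auto simp: coord_inject[symmetric] zero_ell2.rep_eq)
  show "norm x = sqrt (inner x x)"
    by (simp add: norm_ell2_def inner_ell2_def power2_norm_eq_inner)
qed

end

definition theta :: "nat \<Rightarrow> real"
  where "theta k = 2 * pi / fact k"

definition rot :: "real \<Rightarrow> real^2^2"
  where "rot t = vector [vector [cos t, - sin t], vector [sin t, cos t]]"

definition R_plane :: "(nat \<Rightarrow> real) \<Rightarrow> nat \<Rightarrow> real^2 \<Rightarrow> real^2"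
  where "R_plane \<xi> k x =
    rot (theta k) *v x + \<xi> k *\<^sub>R vector [1 - cos (theta k), - sin (theta k)]"

text \<open>The values \<open>\<xi> k\<close> matter for \<open>k \<ge> 1\<close> only.  The argument of \<open>Abs_ell2\<close> is
  square-summable if \<open>\<xi>\<close> is positive and decreasing; see \<open>coord_R_ell2\<close> below.\<close>

definition R_ell2 :: "(nat \<Rightarrow> real) \<Rightarrow> ell2 \<Rightarrow> ell2"
  where "R_ell2 \<xi> x = Abs_ell2 (\<lambda>i. R_plane \<xi> (Suc i) (coord x i))"

lemma norm_sq_2: "(norm (v :: real^2))\<^sup>2 = (v $ 1)\<^sup>2 + (v $ 2)\<^sup>2"
  by (simp only: power2_norm_eq_inner) (simp add: inner_vec_def sum_2 power2_eq_square)

lemma norm_rot: "norm (rot t *v x) = norm x"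
proof -
  have "(norm (rot t *v x))\<^sup>2 = ((sin t)\<^sup>2 + (cos t)\<^sup>2) * (norm x)\<^sup>2"
    unfolding norm_sq_2
    by (simp add: rot_def matrix_vector_mult_def sum_2 power2_eq_square algebra_simps
      del: sin_cos_squared_add sin_cos_squared_add2 sin_cos_squared_add3)
  then show ?thesis by simp
qed

lemma norm_sq_shift:
  "(norm (c *\<^sub>R vector [1 - cos t, - sin t] :: real^2))\<^sup>2 \<le> c\<^sup>2 * t\<^sup>2"
proof -
  have "(norm (c *\<^sub>R vector [1 - cos t, - sin t] :: real^2))\<^sup>2
      = c\<^sup>2 * ((1 - cos t)\<^sup>2 + (sin t)\<^sup>2)"
    unfolding norm_sq_2 by (simp add: power_mult_distrib distrib_left)
  also have "(1 - cos t)\<^sup>2 + (sin t)\<^sup>2 = (2 * sin (t / 2))\<^sup>2"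
    using cos_double_sin[of "t / 2"] sin_cos_squared_add[of t]
    by (simp add: power2_diff power_mult_distrib)
  also have "\<dots> \<le> t\<^sup>2"
    using abs_sin_x_le_abs_x[of "t / 2"]
    by (intro abs_le_square_iff[THEN iffD1]) (simp add: abs_mult)
  finally show ?thesis by (simp add: mult_left_mono)
qed

lemma coord_R_ell2:
  assumes "\<And>k. k \<ge> 1 \<Longrightarrow> \<xi> k > 0" and "antimono_on {1..} \<xi>"
  shows "coord (R_ell2 \<xi> x) i = R_plane \<xi> (Suc i) (coord x i)"
proof -
  have "summable (\<lambda>i. (norm (\<xi> (Suc i) *\<^sub>R
      vector [1 - cos (theta (Suc i)), - sin (theta (Suc i))] :: real^2))\<^sup>2)"
  proof (rule summable_comparison_test')
    show "summable (\<lambda>i. (\<xi> 1)\<^sup>2 * (4 * pi\<^sup>2) * inverse (fact i))"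
      by (rule summable_mult[OF summable_exp[of 1, simplified]])
    fix i
    have x: "(\<xi> (Suc i))\<^sup>2 \<le> (\<xi> 1)\<^sup>2"
      using assms(1)[of "Suc i"] monotone_onD[OF assms(2), of 1 "Suc i"]
      by (intro power_mono) auto
    have "(1::real) * fact i \<le> fact (Suc i) * fact (Suc i)"
      by (intro mult_mono fact_mono fact_ge_1) auto
    then have "inverse (fact (Suc i) * fact (Suc i)) \<le> (inverse (fact i) :: real)"
      by (intro le_imp_inverse_le) auto
    then have t: "(theta (Suc i))\<^sup>2 \<le> 4 * pi\<^sup>2 * inverse (fact i)"
      unfolding theta_def
      by (simp add: power2_eq_square divide_inverse mult.assoc mult.left_commute mult_left_mono del: fact_Suc)
    show "norm ((norm (\<xi> (Suc i) *\<^sub>R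
        vector [1 - cos (theta (Suc i)), - sin (theta (Suc i))] :: real^2))\<^sup>2)
        \<le> (\<xi> 1)\<^sup>2 * (4 * pi\<^sup>2) * inverse (fact i)"
      using norm_sq_shift[of "\<xi> (Suc i)" "theta (Suc i)"] mult_mono[OF x t]
      by (simp del: fact_Suc add: mult.assoc)
  qed
  then have "summable (\<lambda>i. (norm (R_plane \<xi> (Suc i) (coord x i)))\<^sup>2)"
    unfolding R_plane_def
    by (intro summable_norm_sq_add) (simp_all add: norm_rot summable_coord)
  then show ?thesis
    unfolding R_ell2_def by (simp add: Abs_ell2_inverse)
qed

lemma dist_R_ell2:
  assumes "\<And>k. k \<ge> 1 \<Longrightarrow> \<xi> k > 0" and "antimono_on {1..} \<xi>"
  shows "dist (R_ell2 \<xi> x) (R_ell2 \<xi> y) = dist x y"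
proof -
  have "R_plane \<xi> k u - R_plane \<xi> k v = rot (theta k) *v (u - v)" for k u v
    by (simp add: R_plane_def matrix_vector_mult_diff_distrib)
  then show ?thesis
    by (simp add: dist_ell2_def norm_ell2_def minus_ell2.rep_eq coord_R_ell2[OF assms] norm_rot)
qed

end

theory Submission
  imports Defs
begin

text \<open>The map \<open>R_plane \<xi> k\<close> is the rotation through the angle \<open>2\<pi> / k!\<close> about the point
  \<open>(\<xi> k, 0)\<close>, so its \<open>m\<close>-th power is the rotation about the same point through \<open>2\<pi> m / k!\<close>, and
  it moves the origin by at most \<open>\<xi> k\<close> times this angle (\<open>coord_funpow_R_ell2_zero\<close> and
  \<open>norm_sq_shift\<close>). Take \<open>m = n!\<close>. For \<open>k \<le> n\<close> the angle is a multiple of \<open>2\<pi>\<close>, so the first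
  \<open>n\<close> coordinates of \<open>\<^bold>R\<^bsup>n!\<^esup>(0)\<close> vanish. For \<open>k = n + 1 + j\<close> the angle is \<open>2\<pi> n! / k!\<close>, which is
  at most \<open>2\<pi> / (n + 1)\<close> and decays at least like \<open>2\<^sup>-\<^sup>j\<close> in \<open>j\<close>. Since \<open>\<xi>\<close> is bounded by
  \<open>\<xi> 1\<close>, the square norm of \<open>\<^bold>R\<^bsup>n!\<^esup>(0)\<close> is dominated by a geometric series whose sum is
  \<open>O(1 / n\<^sup>2)\<close>.\<close>

text \<open>With \<open>c = (\<xi> k, 0)\<close> the vectors below are \<open>c - rot a *v c\<close>, the images of the origin under
  the rotations about \<open>c\<close>; composing such rotations adds their angles.\<close>

lemma R_plane_orbit_step:
  "R_plane \<xi> k (\<xi> k *\<^sub>R vector [1 - cos a, - sin a]) =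
    \<xi> k *\<^sub>R vector [1 - cos (theta k + a), - sin (theta k + a)]"
  by (simp add: R_plane_def rot_def vec_eq_iff forall_2 matrix_vector_mult_def sum_2
      cos_add sin_add algebra_simps)

lemma coord_funpow_R_ell2_zero:
  assumes "\<And>k. k \<ge> 1 \<Longrightarrow> \<xi> k > 0" and "antimono_on {1..} \<xi>"
  shows "coord ((R_ell2 \<xi> ^^ m) 0) i =
    \<xi> (Suc i) *\<^sub>R vector [1 - cos (real m * theta (Suc i)), - sin (real m * theta (Suc i))]"
proof (induction m)
  case 0
  then show ?case by (simp add: zero_ell2.rep_eq vec_eq_iff forall_2)
next
  case (Suc m)
  have "real (Suc m) * theta (Suc i) = theta (Suc i) + real m * theta (Suc i)"
    by (simp add: distrib_right)
  with Suc.IH show ?case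
    by (simp only: funpow.simps comp_apply coord_R_ell2[OF assms] R_plane_orbit_step)
qed

text \<open>The angle \<open>n! \<cdot> 2\<pi> / k!\<close> is an integer multiple of \<open>2\<pi>\<close>, because \<open>k!\<close> divides \<open>n!\<close>.\<close>

lemma coord_funpow_fact_R_ell2_zero_eq_0:
  assumes "\<And>k. k \<ge> 1 \<Longrightarrow> \<xi> k > 0" and "antimono_on {1..} \<xi>" and "i < n"
  shows "coord ((R_ell2 \<xi> ^^ fact n) 0) i = 0"
proof -
  have "(fact (Suc i) :: nat) dvd fact n"
    using \<open>i < n\<close> by (intro fact_dvd) simp
  then obtain q where q: "(fact n :: nat) = fact (Suc i) * q" by (auto simp: dvd_def)
  have "real (fact n) = fact (Suc i) * real q"
    unfolding q of_nat_mult of_nat_fact ..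
  then have angle: "real (fact n) * theta (Suc i) = 2 * pi * real q"
    by (simp add: theta_def del: fact_Suc of_nat_fact)
  have "sin (2 * pi * real q) = 0" "cos (2 * pi * real q) = 1"
    using sin_int_2pin[of "int q"] cos_int_2pin[of "int q"] by simp_all
  then show ?thesis
    by (simp only: coord_funpow_R_ell2_zero[OF assms(1,2)] angle)
      (simp add: vec_eq_iff forall_2)
qed

lemma fact_mult_power2_le: "fact (Suc n) * 2 ^ j \<le> (fact (Suc (n + j)) :: real)"
proof (induction j)
  case (Suc j)
  have "fact (Suc n) * 2 ^ Suc j = 2 * (fact (Suc n) * 2 ^ j :: real)"
    by simp
  also have "\<dots> \<le> real (Suc (Suc (n + j))) * fact (Suc (n + j))"
    using Suc.IH by (intro mult_mono) simp_all
  finally show ?case by simp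
qed simp

lemma fact_theta_le: "real (fact n) * theta (Suc (n + j)) \<le> 2 * pi / real (Suc n) * (1/2) ^ j"
proof -
  have "2 * pi * fact n / fact (Suc (n + j)) \<le> 2 * pi * fact n / (fact (Suc n) * 2 ^ j)"
    by (intro divide_left_mono fact_mult_power2_le mult_nonneg_nonneg mult_pos_pos) simp_all
  also have "\<dots> = 2 * pi / real (Suc n) * (1/2) ^ j"
    by (simp add: power_divide)
  finally show ?thesis by (simp add: theta_def mult_ac del: fact_Suc)
qed

lemma norm_coord_funpow_fact_R_ell2_zero_le:
  assumes "\<And>k. k \<ge> 1 \<Longrightarrow> \<xi> k > 0" and "antimono_on {1..} \<xi>"
  shows "(norm (coord ((R_ell2 \<xi> ^^ fact n) 0) (n + j)))\<^sup>2
    \<le> (2 * pi * \<xi> 1 / real (Suc n))\<^sup>2 * (1/4) ^ j"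
proof -
  let ?k = "Suc (n + j)"
  have xi: "0 \<le> \<xi> ?k" "\<xi> ?k \<le> \<xi> 1"
    using assms(1)[of ?k] monotone_onD[OF assms(2), of 1 ?k] by auto
  have "(norm (coord ((R_ell2 \<xi> ^^ fact n) 0) (n + j)))\<^sup>2
      \<le> (\<xi> ?k * (real (fact n) * theta ?k))\<^sup>2"
    by (simp only: coord_funpow_R_ell2_zero[OF assms] power_mult_distrib[of "\<xi> ?k"] norm_sq_shift)
  also have "\<dots> \<le> (\<xi> 1 * (2 * pi / real (Suc n) * (1/2) ^ j))\<^sup>2"
    using xi by (intro power_mono mult_mono fact_theta_le) (simp_all add: theta_def)
  also have "((1/2 :: real) ^ j)\<^sup>2 = (1/4) ^ j"
    by (simp add: power_commutes power2_eq_square flip: power_mult_distrib)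
  then have "(\<xi> 1 * (2 * pi / real (Suc n) * (1/2) ^ j))\<^sup>2
      = (2 * pi * \<xi> 1 / real (Suc n))\<^sup>2 * (1/4) ^ j"
    by (simp add: power_mult_distrib power_divide)
  finally show ?thesis .
qed

text \<open>Summing the geometric series of ratio \<open>1/4\<close> costs a factor \<open>4/3\<close> in the square norm; it is
  rounded up to \<open>4\<close>, a perfect square.\<close>

lemma norm_funpow_fact_R_ell2_zero_le:
  assumes "\<And>k. k \<ge> 1 \<Longrightarrow> \<xi> k > 0" and "antimono_on {1..} \<xi>"
  shows "norm ((R_ell2 \<xi> ^^ fact n) 0) \<le> 4 * pi * \<xi> 1 / real (Suc n)"
proof -
  let ?f = "\<lambda>i. (norm (coord ((R_ell2 \<xi> ^^ fact n) 0) i))\<^sup>2"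
  let ?B = "2 * pi * \<xi> 1 / real (Suc n)"
  have "?B \<ge> 0" using assms(1)[of 1] by simp
  have geom: "(\<lambda>j. ?B\<^sup>2 * (1/4) ^ j) sums (?B\<^sup>2 * (4/3))"
    using geometric_sums[of "1/4::real"] by (intro sums_mult) simp
  have "(\<Sum>i. ?f i) = (\<Sum>j. ?f (j + n)) + (\<Sum>i<n. ?f i)"
    by (rule suminf_split_initial_segment[OF summable_coord])
  also have "(\<Sum>i<n. ?f i) = 0"
    by (simp add: coord_funpow_fact_R_ell2_zero_eq_0[OF assms])
  also have "(\<Sum>j. ?f (j + n)) \<le> (\<Sum>j. ?B\<^sup>2 * (1/4) ^ j)"
    using norm_coord_funpow_fact_R_ell2_zero_le[OF assms]
    by (intro suminf_le sums_summable[OF geom] summable_ignore_initial_segment summable_coord)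
      (simp add: add.commute[of _ n])
  also have "\<dots> = ?B\<^sup>2 * (4/3)"
    by (rule sums_unique[OF geom, symmetric])
  also have "\<dots> \<le> ?B\<^sup>2 * 4"
    by (intro mult_left_mono) simp_all
  also have "\<dots> = (2 * ?B)\<^sup>2"
    by (simp only: power_mult_distrib) simp
  finally have "(\<Sum>i. ?f i) \<le> (2 * ?B)\<^sup>2" by simp
  then have "norm ((R_ell2 \<xi> ^^ fact n) 0) \<le> 2 * ?B"
    unfolding norm_ell2_def using \<open>?B \<ge> 0\<close> by (intro real_le_lsqrt) simp_all
  then show ?thesis by simp
qed

theorem theorem1:
  fixes \<xi> :: "nat \<Rightarrow> real"
  assumes pos: "\<And>k. k \<ge> 1 \<Longrightarrow> \<xi> k > 0"
    and decreasing: "antimono_on {1..} \<xi>"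
  shows "((\<lambda>n. (R_ell2 \<xi> ^^ fact n) 0) \<longlonglongrightarrow> 0) \<and>
    (\<exists>C\<ge>0. \<forall>\<^sub>F n in sequentially. norm ((R_ell2 \<xi> ^^ fact n) 0) \<le> C / real n)"
proof -
  define C where "C = 4 * pi * \<xi> 1"
  have "C \<ge> 0" using pos[of 1] by (simp add: C_def)
  have bound: "\<forall>\<^sub>F n in sequentially. norm ((R_ell2 \<xi> ^^ fact n) 0) \<le> C / real n"
    using eventually_gt_at_top[of 0]
  proof eventually_elim
    case (elim n)
    have "norm ((R_ell2 \<xi> ^^ fact n) 0) \<le> C / real (Suc n)"
      unfolding C_def by (rule norm_funpow_fact_R_ell2_zero_le[OF pos decreasing])
    also have "\<dots> \<le> C / real n"
      using \<open>C \<ge> 0\<close> elim by (intro divide_left_mono) simp_all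
    finally show ?case .
  qed
  then have "(\<lambda>n. (R_ell2 \<xi> ^^ fact n) 0) \<longlonglongrightarrow> 0"
    by (rule Lim_null_comparison) (rule lim_const_over_n)
  with bound \<open>C \<ge> 0\<close> show ?thesis by blast
qed

end
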